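(* Fix $\tau\in\{231,312\}$. If $\Pi_n$ is a uniformly random element of $\mathbf{Iv}_n(\tau)$, then $\mathbb{E}(fp(\Pi_n))=\frac{n}{3}+O(1)$, $\mathrm{Var}(fp(\Pi_n))=\frac{8}{27}n+O(1)$, and \[ \frac{fp(\Pi_n)-\frac13 n}{\sqrt{8n/27}} \rightarrow_d Z,\] where $Z$ is a standard normal random variable.
   Context: For a permutation $\pi$, $fp(\pi)$ denotes its number of fixed points. A permutation $\pi$ of $[n]$ contains a pattern $\tau\in S_3$ if there are indices $i_1<i_2<i_3$ such that $(\pi_{i_1},\pi_{i_2},\pi_{i_3})$ is in the same relative order as $\tau$; otherwise $\pi$ avoids $\tau$. An involution is a permutation with $\pi^{-1}=\pi$. $\mathbf{Iv}_n(\tau)$ is the set of $\tau$-avoiding involutions of $[n]$. $\rightarrow_d$ denotes convergence in distribution as $n\to\infty$. *)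

theory Defs
  imports "HOL-Probability.Probability" "HOL-Combinatorics.Permutations"
begin

(* A permutation of [n] is a function p :: nat => nat with p permutes {1..n}; such a function
   is the identity outside [n], so fixed points are counted inside {1..n} only. *)
definition fp :: "nat \<Rightarrow> (nat \<Rightarrow> nat) \<Rightarrow> nat" where
  "fp n p = card {i \<in> {1..n}. p i = i}"

(* The pattern is given in one-line notation, e.g. 231 is [2, 3, 1]. *)
definition contains_pattern :: "nat \<Rightarrow> (nat \<Rightarrow> nat) \<Rightarrow> nat list \<Rightarrow> bool" where
  "contains_pattern n p \<tau> \<longleftrightarrow>
     (\<exists>ix :: nat \<Rightarrow> nat. strict_mono_on {..<length \<tau>} ix \<and> ix ` {..<length \<tau>} \<subseteq> {1..n} \<and>
        (\<forall>a<length \<tau>. \<forall>b<length \<tau>. p (ix a) < p (ix b) \<longleftrightarrow> \<tau> ! a < \<tau> ! b))"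

definition Iv :: "nat \<Rightarrow> nat list \<Rightarrow> (nat \<Rightarrow> nat) set" where
  "Iv n \<tau> = {p. p permutes {1..n} \<and> inv p = p \<and> \<not> contains_pattern n p \<tau>}"

end

theory Submission
  imports Defs "HOL-Real_Asymp.Real_Asymp"
begin

text \<open>An involution avoiding 231 (equivalently 312) is layered: it reverses each of
  a sequence of consecutive blocks of \<open>[n]\<close>, so it corresponds to a composition of \<open>n\<close>, and its
  fixed points correspond to the odd parts. Splitting off the last block gives
  \<open>P (n + 2) = u * P (n + 1) + 2 * P n\<close> for the generating polynomials \<open>P n\<close> of fixed points. At \<open>u = 1\<close>
  this yields exact moments. At \<open>u = exp (\<i> * s)\<close> it expresses the characteristic function through
  powers of the two roots of \<open>x\<^sup>2 = u * x + 2\<close>; half the dominant root, centred, is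
  \<open>1 - 4/27 * s\<^sup>2 + o(s\<^sup>2)\<close>, and Levy's continuity theorem applies.\<close>

section \<open>Pattern-avoiding involutions as functions on \<open>nat\<close>\<close>

lemma contains_pattern_231:
  "contains_pattern n p [2, 3, 1] \<longleftrightarrow>
    (\<exists>a b c. 1 \<le> a \<and> a < b \<and> b < c \<and> c \<le> n \<and> p c < p a \<and> p a < p b)" (is "?L \<longleftrightarrow> ?R")
proof
  assume ?L
  then obtain ix :: "nat \<Rightarrow> nat" where ix: "strict_mono_on {..<3} ix" "ix ` {..<3} \<subseteq> {1..n}"
    "\<forall>a<3. \<forall>b<3. p (ix a) < p (ix b) \<longleftrightarrow> [2, 3, 1::nat] ! a < [2, 3, 1] ! b"
    unfolding contains_pattern_def by (auto simp: eval_nat_numeral)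
  have "ix 0 < ix 1" "ix 1 < ix 2"
    using ix(1) by (auto simp: strict_mono_on_def)
  moreover have "1 \<le> ix 0" "ix 2 \<le> n"
    using ix(2) by (auto simp: image_subset_iff)
  moreover have "p (ix 2) < p (ix 0)" "p (ix 0) < p (ix 1)"
    using ix(3)[rule_format, of 2 0] ix(3)[rule_format, of 0 1] by auto
  ultimately show ?R by blast
next
  assume ?R
  then obtain a b c where "1 \<le> a" "a < b" "b < c" "c \<le> n" "p c < p a" "p a < p b"
    by auto
  then show ?L
    unfolding contains_pattern_def
    by (intro exI[of _ "(!) [a, b, c]"])
       (auto simp: strict_mono_on_def less_Suc_eq numeral_3_eq_3)
qed

lemma contains_pattern_312:
  "contains_pattern n p [3, 1, 2] \<longleftrightarrow>
    (\<exists>a b c. 1 \<le> a \<and> a < b \<and> b < c \<and> c \<le> n \<and> p b < p c \<and> p c < p a)" (is "?L \<longleftrightarrow> ?R")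
proof
  assume ?L
  then obtain ix :: "nat \<Rightarrow> nat" where ix: "strict_mono_on {..<3} ix" "ix ` {..<3} \<subseteq> {1..n}"
    "\<forall>a<3. \<forall>b<3. p (ix a) < p (ix b) \<longleftrightarrow> [3, 1, 2::nat] ! a < [3, 1, 2] ! b"
    unfolding contains_pattern_def by (auto simp: eval_nat_numeral)
  have "ix 0 < ix 1" "ix 1 < ix 2"
    using ix(1) by (auto simp: strict_mono_on_def)
  moreover have "1 \<le> ix 0" "ix 2 \<le> n"
    using ix(2) by (auto simp: image_subset_iff)
  moreover have "p (ix 1) < p (ix 2)" "p (ix 2) < p (ix 0)"
    using ix(3)[rule_format, of 1 2] ix(3)[rule_format, of 2 0] by auto
  ultimately show ?R by blast
next
  assume ?R
  then obtain a b c where "1 \<le> a" "a < b" "b < c" "c \<le> n" "p b < p c" "p c < p a"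
    by auto
  then show ?L
    unfolding contains_pattern_def
    by (intro exI[of _ "(!) [a, b, c]"])
       (auto simp: strict_mono_on_def less_Suc_eq numeral_3_eq_3)
qed

text \<open>The pattern condition is imposed on all of \<open>nat\<close>: a permutation that fixes
  everything outside \<open>{1..n}\<close> has no occurrence of 231 that leaves this interval.\<close>

definition layered :: "nat \<Rightarrow> (nat \<Rightarrow> nat) set" where
  "layered n = {p. p permutes {1..n} \<and> (\<forall>i. p (p i) = i) \<and>
     (\<forall>a b c. a < b \<longrightarrow> b < c \<longrightarrow> p c < p a \<longrightarrow> \<not> p a < p b)}"

lemma involution_imp_permutes:
  assumes "\<And>i. p (p i) = i" "\<And>i. i \<notin> S \<Longrightarrow> p i = i"
  shows "p permutes S"
  unfolding permutes_def using assms by metis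

lemma permutes_inv_eq_self_iff:
  assumes "p permutes S"
  shows "inv p = p \<longleftrightarrow> (\<forall>i. p (p i) = i)"
  using assms by (metis permutes_inv_eq ext)

lemma Iv_231: "Iv n [2, 3, 1] = layered n"
proof (intro equalityI subsetI)
  fix p assume p: "p \<in> layered n"
  then show "p \<in> Iv n [2, 3, 1]"
    unfolding layered_def Iv_def contains_pattern_231
    by (auto simp: permutes_inv_eq_self_iff)
next
  fix p assume p: "p \<in> Iv n [2, 3, 1]"
  then have perm: "p permutes {1..n}" and inv: "\<forall>i. p (p i) = i"
    and av: "\<And>a b c. 1 \<le> a \<Longrightarrow> a < b \<Longrightarrow> b < c \<Longrightarrow> c \<le> n \<Longrightarrow> p c < p a \<Longrightarrow> \<not> p a < p b"
    unfolding Iv_def contains_pattern_231 by (auto simp: permutes_inv_eq_self_iff)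
  have out: "p i = i" if "\<not> (1 \<le> i \<and> i \<le> n)" for i
    using perm that by (auto simp: permutes_def)
  have inn: "1 \<le> p i \<and> p i \<le> n" if "1 \<le> i \<and> i \<le> n" for i
    using permutes_in_image[OF perm, of i] that by auto
  have "\<not> p a < p b" if "a < b" "b < c" "p c < p a" for a b c
  proof -
    \<comment> \<open>For \<open>a = 0\<close> the value \<open>p a = 0\<close> cannot exceed
      \<open>p c\<close>.\<close>
    have "1 \<le> a" using that out[of a] by (cases "a = 0") auto
    \<comment> \<open>A position \<open>c > n\<close> is fixed, whereas \<open>p a\<close> is at
      most \<open>n\<close> for \<open>a\<close> inside the interval and equals \<open>a < c\<close>
      outside it, so \<open>p c < p a\<close> fails.\<close>
    moreover have "c \<le> n"
    proof (rule ccontr)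
      assume "\<not> c \<le> n"
      then have "p c = c" using out by auto
      then show False using inn[of a] out[of a] that \<open>\<not> c \<le> n\<close>
        by (cases "1 \<le> a \<and> a \<le> n") auto
    qed
    ultimately show ?thesis using av that by blast
  qed
  then show "p \<in> layered n"
    using perm inv by (auto simp: layered_def)
qed

text \<open>The patterns 231 and 312 are inverse to each other and an involution is its own inverse:
  exchanging positions with values turns an occurrence of one pattern into an occurrence of the
  other.\<close>

lemma Iv_312: "Iv n [3, 1, 2] = Iv n [2, 3, 1]"
proof -
  have "contains_pattern n p [3, 1, 2] \<longleftrightarrow> contains_pattern n p [2, 3, 1]"
    if perm: "p permutes {1..n}" and inv: "\<And>i. p (p i) = i" for p
  proof
    have inn: "1 \<le> p i \<and> p i \<le> n" if "1 \<le> i" "i \<le> n" for i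
      using permutes_in_image[OF perm, of i] that by auto
    show "contains_pattern n p [2, 3, 1]" if pat: "contains_pattern n p [3, 1, 2]"
    proof -
      obtain a b c where abc: "1 \<le> a" "a < b" "b < c" "c \<le> n" "p b < p c" "p c < p a"
        using pat unfolding contains_pattern_312 by blast
      then show ?thesis
        using inn[of b] inn[of a] unfolding contains_pattern_231
        by (intro exI[of _ "p b"] exI[of _ "p c"] exI[of _ "p a"]) (auto simp: inv)
    qed
    show "contains_pattern n p [3, 1, 2]" if pat: "contains_pattern n p [2, 3, 1]"
    proof -
      obtain a b c where abc: "1 \<le> a" "a < b" "b < c" "c \<le> n" "p c < p a" "p a < p b"
        using pat unfolding contains_pattern_231 by blast
      then show ?thesis
        using inn[of b] inn[of c] unfolding contains_pattern_312
        by (intro exI[of _ "p c"] exI[of _ "p a"] exI[of _ "p b"]) (auto simp: inv)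
    qed
  qed
  then show ?thesis
    unfolding Iv_def by (auto simp: permutes_inv_eq_self_iff)
qed

section \<open>Appending and removing the last layer\<close>

definition add_layer :: "nat \<Rightarrow> nat \<Rightarrow> (nat \<Rightarrow> nat) \<Rightarrow> nat \<Rightarrow> nat" where
  "add_layer n m q i = (if m < i \<and> i \<le> n then n + m + 1 - i else q i)"

lemma layeredD:
  assumes "p \<in> layered n"
  shows "p permutes {1..n}" "p (p i) = i" "a < b \<Longrightarrow> b < c \<Longrightarrow> p c < p a \<Longrightarrow> \<not> p a < p b"
    "i \<le> n \<Longrightarrow> p i \<le> n" "n < i \<Longrightarrow> p i = i" "p 0 = 0"
proof -
  show perm: "p permutes {1..n}" 
    using assms unfolding layered_def by blast
  show "p (p i) = i" "a < b \<Longrightarrow> b < c \<Longrightarrow> p c < p a \<Longrightarrow> \<not> p a < p b"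
    using assms unfolding layered_def by blast+
  show out: "n < i \<Longrightarrow> p i = i" and zero: "p 0 = 0"
    using perm by (auto simp: permutes_def)
  show "i \<le> n \<Longrightarrow> p i \<le> n"
    using permutes_in_image[OF perm, of i] zero by (cases "i = 0") auto
qed

text \<open>The positions up to \<open>m\<close>, the new block and the positions beyond
  \<open>n\<close> are mapped to themselves, so the inversion between the outer entries of a 231
  keeps the whole occurrence inside one of the three. There \<open>q\<close> avoids the pattern, the
  block decreases, or the map is the identity.\<close>

lemma add_layer_in_layered:
  assumes q: "q \<in> layered m" and "m < n"
  shows "add_layer n m q \<in> layered n"
proof -
  note q = layeredD[OF q]
  have lo: "add_layer n m q i = q i" "q i \<le> m" if "i \<le> m" for i
    using that q(4) by (auto simp: add_layer_def)
  have mid: "add_layer n m q i = n + m + 1 - i" if "m < i" "i \<le> n" for i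
    using that by (auto simp: add_layer_def)
  have hi: "add_layer n m q i = i" if "n < i" for i
    using that q(5)[of i] \<open>m < n\<close> by (auto simp: add_layer_def)
  have invol: "add_layer n m q (add_layer n m q i) = i" for i
  proof -
    consider "i \<le> m" | "m < i" "i \<le> n" | "n < i" by linarith
    then show ?thesis
      by cases (auto simp: lo mid hi q(2))
  qed
  have "add_layer n m q permutes {1..n}"
  proof (rule involution_imp_permutes[OF invol])
    fix i assume "i \<notin> {1..n}"
    then have "i = 0 \<or> n < i" by auto
    then show "add_layer n m q i = i"
      using hi q(6) by (auto simp: add_layer_def)
  qed
  moreover have "\<not> add_layer n m q a < add_layer n m q b"
    if abc: "a < b" "b < c" and less: "add_layer n m q c < add_layer n m q a" for a b c
  proof (cases "c \<le> m")
    case True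
    then show ?thesis using q(3)[OF abc] less abc by (simp add: lo)
  next
    case False
    have "m < a"
    proof (rule ccontr)
      assume "\<not> m < a"
      then have "add_layer n m q a \<le> m" using lo[of a] by simp
      moreover have "add_layer n m q c > m"
        using False mid[of c] hi[of c] by (cases "c \<le> n") auto
      ultimately show False using less by simp
    qed
    then show ?thesis
      using abc less False mid[of a] mid[of b] mid[of c] hi[of a] hi[of b] hi[of c]
      by (cases "a \<le> n"; cases "b \<le> n"; cases "c \<le> n") auto
  qed
  ultimately show ?thesis
    using invol by (auto simp: layered_def)
qed

text \<open>The last layer starts at \<open>k = p n\<close>. Avoidance of 231 separates it from the
  positions below \<open>k\<close> and forces \<open>p\<close> to decrease on it, and the only
  decreasing bijection of an interval is its reversal.\<close>

lemma layered_decompose: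
  assumes p: "p \<in> layered n" and "0 < n"
  obtains m q where "m < n" "q \<in> layered m" "p = add_layer n m q"
proof -
  note p = layeredD[OF p]
  define k where "k = p n"
  have pk: "p k = n" using p(2) k_def by auto
  have k: "1 \<le> k" "k \<le> n"
    using p(4)[of n] p(6) pk \<open>0 < n\<close> by (auto simp: k_def) (metis not_less_eq_eq less_one neq0_conv le_zero_eq)
  \<comment> \<open>Otherwise the values \<open>p i\<close>, \<open>p k = n\<close> and
    \<open>p n = k\<close> at \<open>i < k < n\<close> form a 231.\<close>
  have low: "p i < k" if "i < k" for i
  proof (rule ccontr)
    assume "\<not> p i < k"
    moreover have "p i \<noteq> k" using p(2)[of i] pk that k by auto
    moreover have "p i \<noteq> n" using p(2)[of i] k_def that by auto
    moreover have "p i \<le> n" using p(4)[of i] that k by auto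
    ultimately have "k < p i" "p i < n" by auto
    moreover from this have "k < n" by auto
    ultimately show False using p(3)[of i k n] that pk k_def by auto
  qed
  have high: "k \<le> p i" if "k \<le> i" for i
    using low[of "p i"] p(2)[of i] that by (cases "p i < k") auto
  \<comment> \<open>An ascent at \<open>i < j\<close>, followed by the smallest value
    \<open>k\<close> at position \<open>n\<close>, would be a 231.\<close>
  have decr: "p j < p i" if "k \<le> i" "i < j" "j \<le> n" for i j
  proof (rule ccontr)
    assume "\<not> p j < p i"
    moreover have "p i \<noteq> p j" using p(2)[of i] p(2)[of j] that by auto
    ultimately have less: "p i < p j" by auto
    then have "j \<noteq> n" using high[OF that(1)] k_def by auto
    moreover have "p i \<noteq> k" using p(2)[of i] pk that by auto
    ultimately show False
      using p(3)[of i j n] less that high[OF that(1)] k_def by auto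
  qed
  \<comment> \<open>Descending from \<open>p k = n\<close> by at least one per step bounds
    \<open>p\<close> from above; climbing leftwards from \<open>p n = k\<close> gives the same bound
    from below.\<close>
  have upper: "k + j \<le> n \<Longrightarrow> p (k + j) + j \<le> n" for j
  proof (induction j)
    case (Suc j)
    then show ?case using decr[of "k + j" "k + Suc j"] by auto
  qed (use pk in auto)
  have lower: "k + j \<le> n \<Longrightarrow> k + j \<le> p (n - j)" for j
  proof (induction j)
    case (Suc j)
    then have "k + j \<le> p (n - j)" "p (n - j) < p (n - Suc j)"
      by (auto intro: decr)
    then show ?case by simp
  qed (use k_def in auto)
  have mid: "p i = n + k - i" if "k \<le> i" "i \<le> n" for i
  proof -
    have "k + (n - i) \<le> n" using that by simp
    from lower[OF this] have "k + (n - i) \<le> p i" using that by simp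
    then show ?thesis using upper[of "i - k"] that by simp
  qed
  \<comment> \<open>Permutations here act on all of \<open>nat\<close>, so the remainder must be the
    identity from \<open>k\<close> on.\<close>
  define q where "q i = (if i < k then p i else i)" for i
  have "q \<in> layered (k - 1)"
    unfolding layered_def
  proof (intro CollectI conjI)
    show inv: "\<forall>i. q (q i) = i"
      using p(2) low by (auto simp: q_def)
    show "q permutes {1..k - 1}"
    proof (rule involution_imp_permutes)
      fix i assume "i \<notin> {1..k - 1}"
      then have "i = 0 \<or> k \<le> i" by auto
      then show "q i = i" using p(6) by (auto simp: q_def)
    qed (use inv in simp)
    show "\<forall>a b c. a < b \<longrightarrow> b < c \<longrightarrow> q c < q a \<longrightarrow> \<not> q a < q b"
    proof (intro allI impI)
      fix a b c :: nat assume *: "a < b" "b < c" "q c < q a"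
      show "\<not> q a < q b"
      proof (cases "c < k")
        case True
        then show ?thesis using p(3)[OF *(1,2)] * by (simp add: q_def)
      next
        case False
        then show ?thesis using * low[of a] by (auto simp: q_def split: if_splits)
      qed
    qed
  qed
  moreover have "p = add_layer n (k - 1) q"
  proof
    fix i
    show "p i = add_layer n (k - 1) q i"
      using mid[of i] p(5)[of i] k by (auto simp: add_layer_def q_def)
  qed
  ultimately show thesis
    using that[of "k - 1" q] k by auto
qed

lemma layered_0: "layered 0 = {id}"
  by (auto simp: layered_def)

lemma finite_layered: "finite (layered n)"
  by (rule finite_subset[OF _ finite_permutations[of "{1..n}"]]) (auto simp: layered_def)

lemma layered_eq_UN:
  assumes "0 < n"
  shows "layered n = (\<Union>m<n. add_layer n m ` layered m)"
  using assms by (auto intro: add_layer_in_layered elim!: layered_decompose[OF _ assms])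

text \<open>Members of \<open>layered m\<close> are the identity beyond \<open>m\<close>, so
  overwriting them there loses no information.\<close>

lemma inj_on_add_layer: "inj_on (add_layer n m) (layered m)"
proof (rule inj_onI)
  fix q q' assume q: "q \<in> layered m" and q': "q' \<in> layered m"
    and eq: "add_layer n m q = add_layer n m q'"
  show "q = q'"
  proof
    fix i
    show "q i = q' i"
      using layeredD(5)[OF q, of i] layeredD(5)[OF q', of i] fun_cong[OF eq, of i]
      by (cases "m < i") (auto simp: add_layer_def)
  qed
qed

text \<open>A reversal fixes only the centre of its block, which is an integer exactly when the
  block has odd length.\<close>

lemma fp_add_layer:
  assumes "m < n"
  shows "fp n (add_layer n m q) = fp m q + (n - m) mod 2"
proof -
  have "{i \<in> {1..n}. add_layer n m q i = i} =
      {i \<in> {1..m}. q i = i} \<union> {i \<in> {m<..n}. 2 * i = n + m + 1}"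
    using assms by (auto simp: add_layer_def)
  moreover have "card {i \<in> {m<..n}. 2 * i = n + m + 1} = (n - m) mod 2"
  proof (cases "even (n - m)")
    case True
    then have "{i \<in> {m<..n}. 2 * i = n + m + 1} = {}"
      using assms by clarsimp presburger
    then show ?thesis using True by auto
  next
    case False
    then have "{i \<in> {m<..n}. 2 * i = n + m + 1} = {(n + m + 1) div 2}"
      using assms by auto
    moreover have "(n - m) mod 2 = 1" using False by presburger
    ultimately show ?thesis by simp
  qed
  moreover have "{i \<in> {1..m}. q i = i} \<inter> {i \<in> {m<..n}. 2 * i = n + m + 1} = {}"
    by auto
  ultimately show ?thesis
    by (simp add: fp_def card_Un_disjoint)
qed

section \<open>The recurrence for sums over layered involutions\<close>

text \<open>A free weight \<open>f\<close> with values in any commutative semiring lets one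
  recurrence serve the count, both moments and the complex generating polynomial.\<close>

definition fp_sum :: "nat \<Rightarrow> (nat \<Rightarrow> 'a) \<Rightarrow> 'a::comm_semiring_1" where
  "fp_sum n f = (\<Sum>p\<in>layered n. f (fp n p))"

lemma fp_sum_0: "fp_sum 0 f = f 0"
  by (simp add: fp_sum_def layered_0 fp_def)

lemma fp_sum_eq_sum:
  assumes "0 < n"
  shows "fp_sum n f = (\<Sum>m<n. fp_sum m (\<lambda>j. f (j + (n - m) mod 2)))"
proof -
  have disj: "add_layer n m ` layered m \<inter> add_layer n m' ` layered m' = {}"
    if "m < n" "m' < n" "m \<noteq> m'" for m m'
  proof -
    \<comment> \<open>The value at \<open>n\<close> is \<open>m + 1\<close>, so it determines
      \<open>m\<close>.\<close>
    have "add_layer n m q \<noteq> add_layer n m' q'" for q q'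
      using that by (auto simp: add_layer_def fun_eq_iff intro!: exI[of _ n])
    then show ?thesis by blast
  qed
  have "fp_sum n f = (\<Sum>m<n. \<Sum>p\<in>add_layer n m ` layered m. f (fp n p))"
    unfolding fp_sum_def layered_eq_UN[OF assms]
    by (rule sum.UNION_disjoint) (use disj finite_layered in auto)
  also have "\<dots> = (\<Sum>m<n. fp_sum m (\<lambda>j. f (j + (n - m) mod 2)))"
    unfolding fp_sum_def
    by (rule sum.cong[OF refl], subst sum.reindex[OF inj_on_add_layer]) (simp add: fp_add_layer)
  finally show ?thesis .
qed

lemma fp_sum_1: "fp_sum (Suc 0) f = f 1"
  by (simp add: fp_sum_eq_sum fp_sum_0)

lemma fp_sum_2: "fp_sum (Suc (Suc 0)) f = f 0 + f 2"
  by (simp add: fp_sum_eq_sum[of "Suc (Suc 0)"] fp_sum_0 fp_sum_1 numeral_2_eq_2)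

text \<open>A last block of length 1 adds a fixed point, and one of length 2 adds none. Shortening a
  longer block by two preserves its parity, so these blocks contribute \<open>fp_sum n f\<close>
  once more. Size 0 is excluded because the empty involution has no last block.\<close>

lemma fp_sum_rec:
  assumes "0 < n"
  shows "fp_sum (n + 2) f = fp_sum (n + 1) (\<lambda>j. f (j + 1)) + 2 * fp_sum n f"
proof -
  have "fp_sum (n + 2) f = (\<Sum>m<n + 2. fp_sum m (\<lambda>j. f (j + (n + 2 - m) mod 2)))"
    by (rule fp_sum_eq_sum) simp
  also have "\<dots> = (\<Sum>m<n. fp_sum m (\<lambda>j. f (j + (n + 2 - m) mod 2)))
      + fp_sum n f + fp_sum (n + 1) (\<lambda>j. f (j + 1))"
    by (simp add: lessThan_Suc add.commute)
  also have "(\<Sum>m<n. fp_sum m (\<lambda>j. f (j + (n + 2 - m) mod 2))) =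
        (\<Sum>m<n. fp_sum m (\<lambda>j. f (j + (n - m) mod 2)))"
  proof (intro sum.cong refl)
    fix m assume "m \<in> {..<n}"
    then have "n + 2 - m = n - m + 2" by auto
    then show "fp_sum m (\<lambda>j. f (j + (n + 2 - m) mod 2)) = fp_sum m (\<lambda>j. f (j + (n - m) mod 2))"
      by simp
  qed
  also have "\<dots> = fp_sum n f"
    by (rule fp_sum_eq_sum[OF assms, symmetric])
  finally show ?thesis by (metis mult_2 add.commute add.assoc)
qed

lemma fp_sum_add: "fp_sum n (\<lambda>j. f j + g j) = fp_sum n f + fp_sum n g"
  by (simp add: fp_sum_def sum.distrib)

lemma fp_sum_mult: "fp_sum n (\<lambda>j. c * f j) = c * fp_sum n f"
  by (simp add: fp_sum_def sum_distrib_left)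

section \<open>Second-order expansion of the dominant root\<close>

text \<open>After subtracting \<open>c / 2 * z\<^sup>2\<close> the derivative is
  \<open>f' z - c * z\<close>, which is o(z) at 0; the mean value inequality on the disc of radius
  \<open>norm z\<close> then bounds the increment by o(\<open>z\<^sup>2\<close>).\<close>

lemma second_order_quotient_tendsto:
  fixes f f' :: "complex \<Rightarrow> complex"
  assumes "0 < r" and f: "\<And>z. z \<in> ball 0 r \<Longrightarrow> (f has_field_derivative f' z) (at z)"
    and f': "(f' has_field_derivative c) (at 0)" "f' 0 = 0"
  shows "((\<lambda>z. (f z - f 0) / z\<^sup>2) \<longlongrightarrow> c / 2) (at 0)"
proof (rule LIM_I)
  fix e :: real assume "0 < e"
  have "\<forall>e>0. \<exists>d>0. \<forall>y. norm (y - 0) < d \<longrightarrow> norm (f' y - f' 0 - c * (y - 0)) \<le> e * norm (y - 0)"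
    using f'(1) unfolding has_field_derivative_def has_derivative_at_alt by blast
  then have "\<exists>d>0. \<forall>y. norm (y - 0) < d \<longrightarrow>
      norm (f' y - f' 0 - c * (y - 0)) \<le> e / 2 * norm (y - 0)"
    using \<open>0 < e\<close> half_gt_zero by blast
  then obtain d where d: "0 < d"
    "\<And>y :: complex. norm y < d \<Longrightarrow> norm (f' y - c * y) \<le> e / 2 * norm y"
    unfolding f'(2) diff_zero by blast
  have "norm ((f z - f 0) / z\<^sup>2 - c / 2) < e" if z: "z \<noteq> 0" "norm z < min d r" for z
  proof -
    define g where "g z = f z - c / 2 * z\<^sup>2" for z
    have "norm (g z - g 0) \<le> (e / 2 * norm z) * norm (z - 0)"
    proof (rule field_differentiable_bound[where S = "cball 0 (norm z)" and f' = "\<lambda>z. f' z - c * z"])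
      fix y :: complex assume y: "y \<in> cball 0 (norm z)"
      then have "(f has_field_derivative f' y) (at y within cball 0 (norm z))"
        using z by (auto intro: has_field_derivative_at_within[OF f])
      then show "(g has_field_derivative f' y - c * y) (at y within cball 0 (norm z))"
        unfolding g_def by (auto intro!: derivative_eq_intros)
      have "norm (f' y - c * y) \<le> e / 2 * norm y"
        using y z by (intro d) auto
      also have "\<dots> \<le> e / 2 * norm z"
        using y \<open>0 < e\<close> by (intro mult_left_mono) auto
      finally show "norm (f' y - c * y) \<le> e / 2 * norm z" .
    qed auto
    moreover have "(f z - f 0) / z\<^sup>2 - c / 2 = (g z - g 0) / z\<^sup>2"
      using z by (simp add: g_def field_simps)
    ultimately have "norm ((f z - f 0) / z\<^sup>2 - c / 2) \<le> e / 2 * norm z * norm z / (norm z)\<^sup>2"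
      unfolding diff_zero by (simp only: norm_divide norm_power) (rule divide_right_mono, simp_all)
    also have "\<dots> = e / 2"
      using z by (simp add: power2_eq_square)
    finally have "norm ((f z - f 0) / z\<^sup>2 - c / 2) \<le> e / 2" .
    then show ?thesis using \<open>0 < e\<close> by simp
  qed
  then show "\<exists>s>0. \<forall>z. z \<noteq> 0 \<and> norm (z - 0) < s \<longrightarrow> norm ((f z - f 0) / z\<^sup>2 - c / 2) < e"
    using d(1) \<open>0 < r\<close> by (intro exI[of _ "min d r"]) auto
qed

text \<open>\<open>major_root z\<close> and \<open>minor_root z\<close> are the roots of \<open>x\<^sup>2 = u * x + 2\<close>, the characteristic
  equation of the recurrence for the generating polynomials of fixed points, at \<open>u = exp (\<i> * z)\<close>.\<close>

definition disc_root :: "complex \<Rightarrow> complex" where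
  "disc_root z = csqrt ((exp (\<i> * z))\<^sup>2 + 8)"

definition major_root :: "complex \<Rightarrow> complex" where
  "major_root z = (exp (\<i> * z) + disc_root z) / 2"

definition minor_root :: "complex \<Rightarrow> complex" where
  "minor_root z = (exp (\<i> * z) - disc_root z) / 2"

lemma disc_root_power2: "disc_root z ^ 2 = (exp (\<i> * z))\<^sup>2 + 8"
  by (simp add: disc_root_def)

lemma disc_root_0: "disc_root 0 = 3"
proof -
  have "csqrt 9 = csqrt (of_real 9)" by simp
  also have "\<dots> = of_real (sqrt 9)" by (subst of_real_sqrt) auto
  also have "sqrt 9 = sqrt (3 ^ 2)" by simp
  also have "\<dots> = 3" by (rule real_sqrt_unique) auto
  finally show ?thesis by (simp add: disc_root_def)
qed

lemma roots_power2:
  "major_root z ^ 2 = exp (\<i> * z) * major_root z + 2"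
  "minor_root z ^ 2 = exp (\<i> * z) * minor_root z + 2"
  using disc_root_power2[of z]
  by (simp_all add: major_root_def minor_root_def field_simps power2_eq_square)

text \<open>If \<open>norm x > 2\<close>, the squared norm exceeds \<open>2 * norm x\<close>, while
  the equation caps it at \<open>norm x + 2\<close>. At real arguments this gives half of either
  root norm at most 1.\<close>

lemma norm_le_2_of_quadratic:
  fixes x u :: complex
  assumes "x ^ 2 = u * x + 2" "norm u \<le> 1"
  shows "norm x \<le> 2"
proof (rule ccontr)
  assume *: "\<not> norm x \<le> 2"
  have "norm x ^ 2 = norm (u * x + 2)"
    using assms(1) by (metis norm_power)
  also have "\<dots> \<le> norm u * norm x + 2"
    using norm_triangle_ineq[of "u * x" 2] by (simp add: norm_mult)
  also have "\<dots> \<le> norm x + 2"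
    using assms(2) by (simp add: mult_left_le_one_le)
  finally have "norm x ^ 2 \<le> norm x + 2" .
  moreover have "2 * norm x < norm x ^ 2"
    unfolding power2_eq_square using * by (intro mult_strict_right_mono) auto
  ultimately show False using * by simp
qed

lemma norm_roots_le:
  "norm (major_root (of_real s)) \<le> 2" "norm (minor_root (of_real s)) \<le> 2"
  by (rule norm_le_2_of_quadratic[OF roots_power2(1)] norm_le_2_of_quadratic[OF roots_power2(2)],
      simp)+

text \<open>Keeps the radicand off the branch cut of \<open>csqrt\<close>: the squared exponential
  has norm at most e < 8, so the real part stays positive.\<close>

lemma exp_power2_plus_8_nonpos:
  assumes "z \<in> ball 0 (1/2)"
  shows "(exp (\<i> * z))\<^sup>2 + 8 \<notin> \<real>\<^sub>\<le>\<^sub>0"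
proof -
  have "\<bar>Im z\<bar> \<le> 1/2"
    using assms abs_Im_le_cmod[of z] by simp
  then have "norm ((exp (\<i> * z))\<^sup>2) \<le> exp 1"
    by (simp add: norm_power power2_eq_square flip: exp_add)
  also have "\<dots> \<le> (3::real)" by (rule exp_le)
  finally have "\<bar>Re ((exp (\<i> * z))\<^sup>2)\<bar> \<le> 3"
    using abs_Re_le_cmod order_trans by blast
  then have "Re ((exp (\<i> * z))\<^sup>2 + 8) > 0"
    by (simp only: plus_complex.simps) simp
  then show ?thesis
    by (auto simp: complex_nonpos_Reals_iff simp del: plus_complex.simps)
qed

lemma disc_root_nonzero:
  assumes "z \<in> ball 0 (1/2)"
  shows "disc_root z \<noteq> 0"
  using exp_power2_plus_8_nonpos[OF assms] by (auto simp: disc_root_def)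

lemma has_field_derivative_disc_root:
  assumes "z \<in> ball 0 (1/2)"
  shows "(disc_root has_field_derivative \<i> * (exp (\<i> * z))\<^sup>2 / disc_root z) (at z)"
  unfolding disc_root_def
  by (rule derivative_eq_intros refl exp_power2_plus_8_nonpos[OF assms])+
     (simp add: power2_eq_square)

text \<open>The base of the leading power in the characteristic function: the division by 2 matches
  the \<open>2 ^ n\<close> growth of the count, and the exponential subtracts the mean
  \<open>n / 3\<close>.\<close>

definition centred_root :: "complex \<Rightarrow> complex" where
  "centred_root z = major_root z / 2 * exp (- (\<i> * z / 3))"

lemma centred_root_0: "centred_root 0 = 1"
  by (simp add: centred_root_def major_root_def disc_root_0)

lemma has_field_derivative_centred_root:
  assumes "z \<in> ball 0 (1/2)"
  shows "(centred_root has_field_derivative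
           \<i> * centred_root z * (exp (\<i> * z) / disc_root z - 1 / 3)) (at z)"
proof -
  note nz = disc_root_nonzero[OF assms]
  have "(major_root has_field_derivative (\<i> * exp (\<i> * z) + \<i> * (exp (\<i> * z))\<^sup>2 / disc_root z) / 2) (at z)"
    unfolding major_root_def
    by (rule has_field_derivative_disc_root[OF assms] derivative_eq_intros refl)+ simp_all
  \<comment> \<open>With \<open>u\<close> the exponential and \<open>d\<close> the discriminant
    root, \<open>u + u\<^sup>2 / d = (u + d) * (u / d)\<close>, so the logarithmic derivative of the
    major root is \<open>\<i> * u / d\<close>.\<close>
  moreover have "(\<i> * exp (\<i> * z) + \<i> * (exp (\<i> * z))\<^sup>2 / disc_root z) / 2 =
      \<i> * major_root z * (exp (\<i> * z) / disc_root z)"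
    using nz by (simp add: major_root_def add_divide_distrib power2_eq_square algebra_simps)
  ultimately have major: "(major_root has_field_derivative
      \<i> * major_root z * (exp (\<i> * z) / disc_root z)) (at z)"
    by simp
  have "((\<lambda>z. exp (- (\<i> * z / 3))) has_field_derivative
      exp (- (\<i> * z / 3)) * - (\<i> / 3)) (at z)"
    using DERIV_fun_exp[OF DERIV_cmult_Id[of "- (\<i> / 3)" z UNIV]] by simp
  from DERIV_mult[OF DERIV_cdivide[OF major, of 2] this] show ?thesis
    unfolding centred_root_def by (rule DERIV_cong) (simp add: algebra_simps)
qed

lemma centred_root_expansion:
  "((\<lambda>z. (centred_root z - 1) / z\<^sup>2) \<longlongrightarrow> - 4 / 27) (at 0)"
proof -
  define f' where "f' z = \<i> * centred_root z * (exp (\<i> * z) / disc_root z - 1 / 3)" for z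
  have "((\<lambda>z. (centred_root z - centred_root 0) / z\<^sup>2) \<longlongrightarrow> (- 8 / 27) / 2) (at 0)"
  proof (rule second_order_quotient_tendsto[of "1/2" _ f'])
    show "(centred_root has_field_derivative f' z) (at z)" if "z \<in> ball 0 (1/2)" for z
      unfolding f'_def by (rule has_field_derivative_centred_root[OF that])
    show "f' 0 = 0"
      by (simp add: f'_def disc_root_0)
    \<comment> \<open>At 0 one has \<open>u = 1\<close>, \<open>d = 3\<close>,
      \<open>u' = \<i>\<close> and \<open>d' = \<i> / 3\<close>, so \<open>u / d\<close> has
      derivative \<open>8 * \<i> / 27\<close>; the outer factor \<open>\<i>\<close> makes it
      \<open>- 8 / 27\<close>, minus the variance per position.\<close>
    have "(disc_root has_field_derivative \<i> / 3) (at 0)"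
      using has_field_derivative_disc_root[of 0] by (simp add: disc_root_0)
    moreover have "(centred_root has_field_derivative 0) (at 0)"
      using has_field_derivative_centred_root[of 0] by (simp add: disc_root_0)
    moreover have "((\<lambda>z. exp (\<i> * z)) has_field_derivative \<i>) (at 0)"
      by (rule derivative_eq_intros refl)+ simp_all
    ultimately show "(f' has_field_derivative - 8 / 27) (at 0)"
      unfolding f'_def
      by (auto intro!: derivative_eq_intros simp: disc_root_0 centred_root_0)
  qed simp
  then show ?thesis by (simp add: centred_root_0)
qed

section \<open>The Gaussian limit of powers of the centred root\<close>

text \<open>The comparison is with \<open>w n ^ n\<close>, an exponential limit. Both bases
  eventually have norm at most 1, so the powers differ by at most \<open>n\<close> times the
  difference of the bases. The case \<open>t = 0\<close> is separate because the expansion is a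
  limit at nonzero arguments.\<close>

lemma centred_root_power_tendsto:
  "(\<lambda>n. centred_root (of_real (t / sqrt (8 * real n / 27))) ^ n) \<longlonglongrightarrow> of_real (exp (- (t\<^sup>2) / 2))"
proof (cases "t = 0")
  case True
  then show ?thesis by (simp add: centred_root_0)
next
  case False
  define s where "s n = complex_of_real (t / sqrt (8 * real n / 27))" for n
  define w where "w n = complex_of_real (1 + (- (t\<^sup>2) / 2) / real n)" for n
  have "(\<lambda>n. t / sqrt (8 * real n / 27)) \<longlonglongrightarrow> 0"
    by real_asymp
  then have "s \<longlonglongrightarrow> 0"
    unfolding s_def by (metis of_real_0 tendsto_of_real)
  moreover have "eventually (\<lambda>n. s n \<noteq> 0) sequentially"
    using eventually_gt_at_top[of 0] by eventually_elim (simp add: s_def False)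
  ultimately have "filterlim s (at 0) sequentially"
    by (simp add: filterlim_at)
  then have "(\<lambda>n. (centred_root (s n) - 1) / (s n)\<^sup>2) \<longlonglongrightarrow> - 4 / 27"
    by (rule filterlim_compose[OF centred_root_expansion])
  \<comment> \<open>The factor \<open>27 * t\<^sup>2 / 8\<close> is
    \<open>n * (s n)\<^sup>2\<close>; multiplied by \<open>- 4 / 27\<close> it yields the exponent
    \<open>- (t\<^sup>2) / 2\<close>.\<close>
  then have "(\<lambda>n. norm (of_real (27 * t\<^sup>2 / 8) * ((centred_root (s n) - 1) / (s n)\<^sup>2 - - 4 / 27)))
      \<longlonglongrightarrow> norm (complex_of_real (27 * t\<^sup>2 / 8) * (- 4 / 27 - - 4 / 27))"
    by (intro tendsto_norm tendsto_mult tendsto_diff tendsto_const)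
  then have lim0: "(\<lambda>n. norm (of_real (27 * t\<^sup>2 / 8) * ((centred_root (s n) - 1) / (s n)\<^sup>2 - - 4 / 27)))
      \<longlonglongrightarrow> 0"
    by simp
  have "(\<lambda>n. 1 + (- (t\<^sup>2) / 2) / real n) \<longlonglongrightarrow> 1"
    by real_asymp
  then have "eventually (\<lambda>n. 0 < 1 + (- (t\<^sup>2) / 2) / real n) sequentially"
    by (rule order_tendstoD) simp
  then have bound: "eventually (\<lambda>n. norm (centred_root (s n) ^ n - w n ^ n) \<le>
      norm (of_real (27 * t\<^sup>2 / 8) * ((centred_root (s n) - 1) / (s n)\<^sup>2 - - 4 / 27))) sequentially"
    using eventually_gt_at_top[of 0]
  proof eventually_elim
    case (elim n)
    have s2: "(s n)\<^sup>2 = of_real (27 * t\<^sup>2 / (8 * real n))"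
      using elim by (simp add: s_def power_divide flip: of_real_power)
    have "norm (centred_root (s n)) \<le> 1"
      using norm_roots_le(1)[of "t / sqrt (8 * real n / 27)"]
      by (simp add: centred_root_def s_def norm_mult norm_divide)
    moreover have "norm (w n) \<le> 1"
      unfolding w_def norm_of_real using elim by (auto simp: abs_le_iff)
    ultimately have "norm (centred_root (s n) ^ n - w n ^ n) \<le> n * norm (centred_root (s n) - w n)"
      by (rule norm_power_diff)
    also have "\<dots> = norm (of_nat n * (centred_root (s n) - w n))"
      by (simp add: norm_mult)
    also have "of_nat n * (centred_root (s n) - w n) =
        of_real (27 * t\<^sup>2 / 8) * ((centred_root (s n) - 1) / (s n)\<^sup>2 - - 4 / 27)"
      unfolding s2 using elim False by (simp add: w_def field_simps)
    finally show ?case .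
  qed
  have "(\<lambda>n. centred_root (s n) ^ n - w n ^ n) \<longlonglongrightarrow> 0"
    by (rule Lim_null_comparison[OF bound lim0])
  moreover have "(\<lambda>n. w n ^ n) \<longlonglongrightarrow> of_real (exp (- (t\<^sup>2) / 2))"
    unfolding w_def of_real_power[symmetric]
    by (intro tendsto_of_real tendsto_exp_limit_sequentially)
  ultimately have "(\<lambda>n. (centred_root (s n) ^ n - w n ^ n) + w n ^ n) \<longlonglongrightarrow> 0 + of_real (exp (- (t\<^sup>2) / 2))"
    by (rule tendsto_add)
  then show ?thesis
    by (simp add: s_def)
qed

section \<open>Closed forms of the sums\<close>

text \<open>The shift starts at sizes 1 and 2, matching the two base cases of
  \<open>induct_nat_012\<close>.\<close>

lemma fp_sum_Suc:
  "fp_sum (Suc (Suc (Suc n))) f = fp_sum (Suc (Suc n)) (\<lambda>j. f (j + 1)) + 2 * fp_sum (Suc n) f"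
  using fp_sum_rec[of "Suc n" f] by simp

lemma fp_sum_const: "fp_sum (Suc n) (\<lambda>_. 1) = 2 ^ n"
proof (induction n rule: induct_nat_012)
  case (ge2 n)
  then show ?case by (simp add: fp_sum_Suc) (simp flip: distrib_right)
qed (simp_all add: fp_sum_1 fp_sum_2)

lemma card_layered: "card (layered (Suc n)) = 2 ^ n"
  using fp_sum_const[of n, where ?'a = nat] by (simp add: fp_sum_def)

text \<open>At \<open>u = 1\<close> the characteristic roots are 2 and -1. The inhomogeneous term is
  a power of 2 and resonates with the root 2, hence the linear factor.\<close>

lemma fp_sum_of_nat:
  "fp_sum (Suc n) real = 2 ^ n * ((real n + 1) / 3 + 4 / 9) + 2 / 9 * (- 1) ^ n"
proof (induction n rule: induct_nat_012)
  case (ge2 n)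
  then show ?case
    by (simp add: fp_sum_Suc fp_sum_add fp_sum_const) (simp add: field_simps)
qed (simp_all add: fp_sum_1 fp_sum_2)

text \<open>The first moment now enters as inhomogeneous term and resonates with both roots: the
  factor of \<open>2 ^ n\<close> becomes quadratic and that of \<open>(- 1) ^ n\<close>
  linear.\<close>

lemma fp_sum_of_nat_power2:
  "fp_sum (Suc n) (\<lambda>j. (real j)\<^sup>2) =
     2 ^ n * ((real n + 1)\<^sup>2 / 9 + 16 / 27 * (real n + 1) + 8 / 27) - 4 / 27 * real n * (- 1) ^ n"
proof (induction n rule: induct_nat_012)
  case (ge2 n)
  have "(\<lambda>j. (real (j + 1))\<^sup>2) = (\<lambda>j. (real j)\<^sup>2 + (2 * real j + 1))"
    by (simp add: power2_eq_square algebra_simps)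
  then have "fp_sum (Suc (Suc n)) (\<lambda>j. (real (j + 1))\<^sup>2) =
      fp_sum (Suc (Suc n)) (\<lambda>j. (real j)\<^sup>2) + (2 * fp_sum (Suc (Suc n)) real + 2 ^ Suc n)"
    by (simp only: fp_sum_add fp_sum_mult fp_sum_const)
  then show ?case
    unfolding fp_sum_Suc ge2 fp_sum_of_nat
    by (simp add: power2_eq_square field_simps)
qed (simp_all add: fp_sum_1 fp_sum_2)

text \<open>A Binet formula: \<open>a\<close> and \<open>b\<close> are the roots of
  \<open>x\<^sup>2 = u * x + 2\<close> with \<open>u = a + b\<close>, and the coefficients are
  fitted to sizes 1 and 2.\<close>

lemma fp_sum_power:
  fixes a b :: "'a::field_char_0"
  assumes "a * b = - 2"
  shows "(a - b) * fp_sum (Suc n) (\<lambda>j. (a + b) ^ j) =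
           (a + b / 2) * a ^ Suc n - (a / 2 + b) * b ^ Suc n"
proof (induction n rule: induct_nat_012)
  case 1
  \<comment> \<open>The size-2 sum is \<open>u\<^sup>2 + 1\<close>, with the 1 written as
    \<open>- (a * b) / 2\<close>.\<close>
  have "(a + b / 2) * a ^ 2 - (a / 2 + b) * b ^ 2 = (a - b) * ((a + b) ^ 2 - (a * b) / 2)"
    by (simp add: power2_eq_square field_simps)
  then show ?case
    by (simp add: assms fp_sum_2 power2_eq_square algebra_simps)
next
  case (ge2 n)
  have sq: "a * a = (a + b) * a + 2" "b * b = (a + b) * b + 2"
    using assms by (simp_all add: algebra_simps)
  have "(a - b) * fp_sum (Suc (Suc (Suc n))) (\<lambda>j. (a + b) ^ j) =
      (a + b) * ((a - b) * fp_sum (Suc (Suc n)) (\<lambda>j. (a + b) ^ j)) +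
      2 * ((a - b) * fp_sum (Suc n) (\<lambda>j. (a + b) ^ j))"
    unfolding fp_sum_Suc Suc_eq_plus1[symmetric] power_Suc fp_sum_mult
    by (simp only: distrib_left mult.left_commute)
  also have "\<dots> = (a + b / 2) * a ^ Suc n * ((a + b) * a + 2) - (a / 2 + b) * b ^ Suc n * ((a + b) * b + 2)"
    unfolding ge2 by (simp add: field_simps)
  also have "\<dots> = (a + b / 2) * a ^ Suc (Suc (Suc n)) - (a / 2 + b) * b ^ Suc (Suc (Suc n))"
    unfolding sq[symmetric] by (simp add: algebra_simps)
  finally show ?case .
qed (simp add: fp_sum_1 field_simps)

section \<open>Mean and variance\<close>

lemma integral_layered:
  fixes f :: "nat \<Rightarrow> 'a::{real_normed_field, banach, second_countable_topology}"
  shows "(LINT p|measure_pmf (pmf_of_set (layered (Suc n))). f (fp (Suc n) p)) =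
    fp_sum (Suc n) f / 2 ^ n"
proof -
  have "layered (Suc n) \<noteq> {}"
    using card_layered[of n] by auto
  then show ?thesis
    by (subst integral_measure_pmf[of "layered (Suc n)"])
       (auto simp: finite_layered card_layered fp_sum_def sum_distrib_left scaleR_conv_of_real
         sum_divide_distrib divide_inverse mult.commute intro!: sum.cong)
qed

lemma expectation_fp:
  "measure_pmf.expectation (pmf_of_set (layered (Suc n))) (\<lambda>p. real (fp (Suc n) p)) =
     (real n + 1) / 3 + 4 / 9 + 2 / 9 * (- 1 / 2) ^ n"
  unfolding integral_layered fp_sum_of_nat power_divide[of "- 1" 2 n]
  by (simp add: add_divide_distrib)

lemma variance_fp:
  "measure_pmf.variance (pmf_of_set (layered (Suc n))) (\<lambda>p. real (fp (Suc n) p)) =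
     8 / 27 * (real n + 1) + 8 / 81 - (8 / 27 * (real n + 1) + 4 / 81) * (- 1 / 2) ^ n
       - 4 / 81 * ((- 1 / 2) ^ n)\<^sup>2"
proof -
  let ?P = "pmf_of_set (layered (Suc n))"
  have fin: "finite (set_pmf ?P)"
    using card_layered[of n] finite_layered[of "Suc n"] by (subst set_pmf_of_set) auto
  have "measure_pmf.variance ?P (\<lambda>p. real (fp (Suc n) p)) =
      measure_pmf.expectation ?P (\<lambda>p. (real (fp (Suc n) p))\<^sup>2) -
      (measure_pmf.expectation ?P (\<lambda>p. real (fp (Suc n) p)))\<^sup>2"
    by (intro measure_pmf.variance_eq integrable_measure_pmf_finite fin)
  also have "measure_pmf.expectation ?P (\<lambda>p. (real (fp (Suc n) p))\<^sup>2) =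
      (real n + 1)\<^sup>2 / 9 + 16 / 27 * (real n + 1) + 8 / 27 - 4 / 27 * real n * (- 1 / 2) ^ n"
    unfolding integral_layered[where f = "\<lambda>j. (real j)\<^sup>2"] fp_sum_of_nat_power2 power_divide[of "- 1" 2 n]
    by (simp add: diff_divide_distrib)
  finally show ?thesis
    unfolding expectation_fp by (simp add: power2_eq_square field_simps)
qed

lemma expectation_fp_asymptotics:
  "(\<lambda>n. measure_pmf.expectation (pmf_of_set (layered n)) (\<lambda>p. real (fp n p)) - real n / 3)
     \<in> O(\<lambda>_. 1)"
proof (rule bigoI[of _ 1])
  show "eventually (\<lambda>n. norm (measure_pmf.expectation (pmf_of_set (layered n)) (\<lambda>p. real (fp n p))
      - real n / 3) \<le> 1 * norm (1::real)) sequentially"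
    using eventually_gt_at_top[of 0]
  proof eventually_elim
    case (elim n)
    then obtain m where m: "n = Suc m" by (cases n) auto
    define w where "w = (- 1 / 2 :: real) ^ m"
    have "\<bar>w\<bar> \<le> 1"
      by (simp add: w_def power_abs power_le_one)
    then have "\<bar>4 / 9 + 2 / 9 * w\<bar> \<le> 1" by linarith
    then show ?case unfolding m expectation_fp w_def[symmetric] by (simp add: add_divide_distrib)
  qed
qed

lemma variance_fp_asymptotics:
  "(\<lambda>n. measure_pmf.variance (pmf_of_set (layered n)) (\<lambda>p. real (fp n p)) - 8 / 27 * real n)
     \<in> O(\<lambda>_. 1)"
proof (rule bigoI[of _ 1])
  show "eventually (\<lambda>n. norm (measure_pmf.variance (pmf_of_set (layered n)) (\<lambda>p. real (fp n p))
      - 8 / 27 * real n) \<le> 1 * norm (1::real)) sequentially"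
    using eventually_gt_at_top[of 0]
  proof eventually_elim
    case (elim n)
    then obtain m where m: "n = Suc m" by (cases n) auto
    define w where "w = (- 1 / 2 :: real) ^ m"
    have absw: "\<bar>w\<bar> = 1 / 2 ^ m"
      by (simp add: w_def power_abs power_divide)
    \<comment> \<open>This controls \<open>(m + 1) * w\<close>, the one error term with an unbounded
      coefficient.\<close>
    have "real m + 1 \<le> 2 ^ m"
      using Suc_leI[OF less_exp[of m]] by (metis of_nat_Suc of_nat_le_iff of_nat_numeral of_nat_power add.commute)
    then have "(real m + 1) * \<bar>w\<bar> \<le> 1"
      by (simp add: absw)
    then have "\<bar>(real m + 1) * w\<bar> \<le> 1" by (simp add: abs_mult)
    moreover have "\<bar>w\<bar> \<le> 1" by (simp add: absw)
    moreover from this have "w\<^sup>2 \<le> 1" by (simp add: abs_square_le_1)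
    moreover have "0 \<le> w\<^sup>2" by simp
    ultimately have "\<bar>8 / 81 - 8 / 27 * ((real m + 1) * w) - 4 / 81 * w - 4 / 81 * w\<^sup>2\<bar> \<le> 1"
      by linarith
    moreover have "measure_pmf.variance (pmf_of_set (layered n)) (\<lambda>p. real (fp n p)) - 8 / 27 * real n =
        8 / 81 - 8 / 27 * ((real m + 1) * w) - 4 / 81 * w - 4 / 81 * w\<^sup>2"
      unfolding m variance_fp w_def[symmetric] by (simp add: algebra_simps)
    ultimately show ?case by simp
  qed
qed

section \<open>Characteristic functions and the central limit theorem\<close>

definition fp_distr :: "nat \<Rightarrow> real measure" where
  "fp_distr n = distr (measure_pmf (pmf_of_set (layered n))) borel
     (\<lambda>p. (real (fp n p) - 1 / 3 * real n) / sqrt (8 * real n / 27))"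

text \<open>The characteristic function is the generating polynomial at
  \<open>u = exp (\<i> * z)\<close>, normalised and centred; the Binet formula splits it into one
  power per root.\<close>

lemma char_fp_distr:
  assumes "0 < n" and z: "z = complex_of_real (t / sqrt (8 * real n / 27))"
    and nz: "disc_root z \<noteq> 0"
  shows "char (fp_distr n) t =
    (2 * major_root z + minor_root z) / disc_root z * centred_root z ^ n -
    (major_root z + 2 * minor_root z) / disc_root z * (minor_root z / 2 * exp (- (\<i> * z / 3))) ^ n"
proof -
  obtain m where m: "n = Suc m" using assms(1) by (cases n) auto
  define a b where "a = major_root z" "b = minor_root z"
  have ab: "a * b = - 2" "a - b = disc_root z" "a + b = exp (\<i> * z)"
    using disc_root_power2[of z]
    by (simp_all add: a_b_def major_root_def minor_root_def field_simps power2_eq_square)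
  define P where "P = fp_sum n (\<lambda>j. (a + b) ^ j)"
  have P: "P = ((a + b / 2) * a ^ n - (a / 2 + b) * b ^ n) / disc_root z"
    using fp_sum_power[OF ab(1), of m] nz by (simp add: P_def m ab field_simps)
  have "char (fp_distr n) t = (CLINT p|measure_pmf (pmf_of_set (layered n)).
      iexp (t * ((real (fp n p) - 1 / 3 * real n) / sqrt (8 * real n / 27))))"
    unfolding char_def fp_distr_def by (subst integral_distr) auto
  also have "\<dots> = (CLINT p|measure_pmf (pmf_of_set (layered n)).
      exp (- (\<i> * z / 3)) ^ n * (a + b) ^ fp n p)"
  proof (intro Bochner_Integration.integral_cong refl)
    fix p
    have "t * ((real (fp n p) - 1 / 3 * real n) / sqrt (8 * real n / 27)) =
        t / sqrt (8 * real n / 27) * (real (fp n p) - real n / 3)"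
      by simp
    then have expo: "complex_of_real (t * ((real (fp n p) - 1 / 3 * real n) / sqrt (8 * real n / 27))) =
        z * (of_nat (fp n p) - of_nat n / 3)"
      unfolding z by (simp only: of_real_mult of_real_diff of_real_divide of_real_of_nat_eq of_real_numeral)
    have "\<i> * (z * (of_nat (fp n p) - of_nat n / 3)) =
        of_nat n * - (\<i> * z / 3) + of_nat (fp n p) * (\<i> * z)"
      by (simp add: algebra_simps)
    then show "iexp (t * ((real (fp n p) - 1 / 3 * real n) / sqrt (8 * real n / 27))) =
        exp (- (\<i> * z / 3)) ^ n * (a + b) ^ fp n p"
      unfolding ab exp_of_nat_mult[symmetric] exp_add[symmetric] expo by simp
  qed
  also have "\<dots> = exp (- (\<i> * z / 3)) ^ n * P / 2 ^ m"
    unfolding m integral_layered[where f = "\<lambda>j. exp (- (\<i> * z / 3)) ^ Suc m * (a + b) ^ j"]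
    by (simp add: fp_sum_mult P_def m)
  \<comment> \<open>There are \<open>2 ^ (n - 1)\<close> involutions; the spare factor 2 turns
    \<open>a + b / 2\<close> into \<open>2 * a + b\<close>.\<close>
  also have "\<dots> = exp (- (\<i> * z / 3)) ^ n * P * 2 / 2 ^ n"
    by (simp add: m)
  also have "\<dots> = (2 * a + b) / disc_root z * (a / 2 * exp (- (\<i> * z / 3))) ^ n -
      (a + 2 * b) / disc_root z * (b / 2 * exp (- (\<i> * z / 3))) ^ n"
  proof -
    have "E * (((a + b / 2) * A - (a / 2 + b) * B) / disc_root z) * 2 / C =
        (2 * a + b) / disc_root z * (A / C * E) - (a + 2 * b) / disc_root z * (B / C * E)"
      if "C \<noteq> 0" for A B C E
      using nz that by (simp add: field_simps)
    then show ?thesis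
      by (simp only: P power_mult_distrib power_divide) simp
  qed
  finally show ?thesis
    by (simp add: a_b_def centred_root_def)
qed

text \<open>At 0 the roots are 2 and -1 and the discriminant root is 3, so the two coefficients tend
  to 1 and 0. The minor power stays bounded by 1 and its term vanishes, leaving the Gaussian limit
  of the major one.\<close>

lemma char_fp_distr_tendsto:
  "(\<lambda>n. char (fp_distr n) t) \<longlonglongrightarrow> of_real (exp (- (t\<^sup>2) / 2))"
proof -
  define z where "z n = complex_of_real (t / sqrt (8 * real n / 27))" for n
  define main where "main z = (2 * major_root z + minor_root z) / disc_root z" for z
  define err where "err z = (major_root z + 2 * minor_root z) / disc_root z" for z
  have "(\<lambda>n. t / sqrt (8 * real n / 27)) \<longlonglongrightarrow> 0"
    by real_asymp
  then have z: "z \<longlonglongrightarrow> 0"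
    unfolding z_def by (metis of_real_0 tendsto_of_real)
  have "isCont disc_root 0"
    using has_field_derivative_disc_root[of 0] by (auto intro: DERIV_isCont)
  then have "isCont main 0" "isCont err 0"
    unfolding main_def err_def major_root_def minor_root_def
    by (auto intro!: continuous_intros simp: disc_root_0)
  from this[THEN isCont_tendsto_compose, OF z]
  have main: "(\<lambda>n. main (z n)) \<longlonglongrightarrow> 1" and err: "(\<lambda>n. err (z n)) \<longlonglongrightarrow> 0"
    by (simp_all add: main_def err_def major_root_def minor_root_def disc_root_0)
  have "(\<lambda>n. err (z n) * (minor_root (z n) / 2 * exp (- (\<i> * z n / 3))) ^ n) \<longlonglongrightarrow> 0"
  proof (rule Lim_null_comparison[OF _ tendsto_norm_zero[OF err]])
    show "eventually (\<lambda>n. norm (err (z n) * (minor_root (z n) / 2 * exp (- (\<i> * z n / 3))) ^ n)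
        \<le> norm (err (z n))) sequentially"
    proof (intro always_eventually allI)
      fix n
      have "norm (minor_root (z n) / 2 * exp (- (\<i> * z n / 3))) \<le> 1"
        using norm_roots_le(2)[of "t / sqrt (8 * real n / 27)"]
        by (simp add: z_def norm_mult norm_divide)
      then show "norm (err (z n) * (minor_root (z n) / 2 * exp (- (\<i> * z n / 3))) ^ n)
          \<le> norm (err (z n))"
        unfolding norm_mult[of "err (z n)"] norm_power
        by (intro mult_left_le power_le_one) auto
    qed
  qed
  then have "(\<lambda>n. main (z n) * centred_root (z n) ^ n -
      err (z n) * (minor_root (z n) / 2 * exp (- (\<i> * z n / 3))) ^ n)
      \<longlonglongrightarrow> 1 * of_real (exp (- (t\<^sup>2) / 2)) - 0"
    using centred_root_power_tendsto[of t] unfolding z_def[symmetric]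
    by (intro tendsto_diff tendsto_mult main)
  \<comment> \<open>On this disc the discriminant root is nonzero, as the formula for the
    characteristic function requires.\<close>
  moreover have "eventually (\<lambda>n. z n \<in> ball 0 (1/2)) sequentially"
    using z by (rule topological_tendstoD) auto
  then have "eventually (\<lambda>n. main (z n) * centred_root (z n) ^ n -
      err (z n) * (minor_root (z n) / 2 * exp (- (\<i> * z n / 3))) ^ n = char (fp_distr n) t) sequentially"
    using eventually_gt_at_top[of 0]
  proof eventually_elim
    case (elim n)
    then show ?case
      unfolding main_def err_def
      using char_fp_distr[OF elim(2) z_def disc_root_nonzero] by simp
  qed
  ultimately show ?thesis
    by (simp add: tendsto_cong)
qed

theorem theorem3:
  fixes \<tau> :: "nat list"
  assumes "\<tau> \<in> {[2, 3, 1], [3, 1, 2]}"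
  shows "(\<lambda>n. measure_pmf.expectation (pmf_of_set (Iv n \<tau>)) (\<lambda>p. real (fp n p)) - real n / 3)
            \<in> O(\<lambda>_. 1) \<and>
         (\<lambda>n. measure_pmf.variance (pmf_of_set (Iv n \<tau>)) (\<lambda>p. real (fp n p)) - 8 / 27 * real n)
            \<in> O(\<lambda>_. 1) \<and>
         weak_conv_m
           (\<lambda>n. distr (measure_pmf (pmf_of_set (Iv n \<tau>))) borel
                  (\<lambda>p. (real (fp n p) - 1 / 3 * real n) / sqrt (8 * real n / 27)))
           std_normal_distribution"
proof -
  have "Iv n \<tau> = layered n" for n
    using assms by (elim insertE) (simp_all only: Iv_312 Iv_231 empty_iff)
  moreover have "weak_conv_m fp_distr std_normal_distribution"
  proof (rule levy_continuity)
    show "real_distribution (fp_distr n)" for n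
      unfolding fp_distr_def by (rule prob_space.real_distribution_distr[OF measure_pmf.prob_space_axioms]) simp
    show "real_distribution std_normal_distribution"
      by (rule real_dist_normal_dist)
    show "(\<lambda>n. char (fp_distr n) t) \<longlonglongrightarrow> char std_normal_distribution t" for t
      using char_fp_distr_tendsto by (simp add: char_std_normal_distribution)
  qed
  ultimately show ?thesis
    using expectation_fp_asymptotics variance_fp_asymptotics
    by (simp add: fp_distr_def[abs_def])
qed

end
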